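(* Let $N=\{1,\dots,n\}$ and let $1\le \alpha\le k\le n$ be integers. Any non-adaptive algorithm (fixed sequence of queries $Q_1,\dots,Q_t\subseteq N$) solving Group Testing for hidden sets of size at most $k$ needs: (i) $\Omega\left(\min\left\{\left(\frac{k}{\alpha}\right)^2, \frac{n}{\alpha} \right\} + k\,\frac{\log\frac{n}{k}}{\log \alpha}\right)$ queries under the feedback $F_{\alpha}(X)=\min\{|X|,\alpha\}$; (ii) $\Omega\left(\min\left\{\left(\frac{k}{\alpha}\right)^2, \frac{n}{\alpha} \right\}\right)$ queries under any feedback function capped at $\alpha$.
   Context: Let $N=\{1,\dots,n\}$. A feedback function is a deterministic function $F$ defined on subsets of $N$. It is capped at $\alpha$ if it outputs one and the same (arbitrary fixed) value on all subsets of $N$ with more than $\alpha$ elements; on sets with at most $\alpha$ elements it may be arbitrary (for instance it may return the set itself). A fixed sequence of queries $Q_1,\dots,Q_t\subseteq N$ solves Group Testing (for parameter $k$) under feedback $F$ if for any two different sets $K_1,K_2\subseteq N$ with $|K_1|,|K_2|\le k$ the feedback vectors $\langle F(Q_1\cap K_1),\dots,F(Q_t\cap K_1)\rangle$ and $\langle F(Q_1\cap K_2),\dots,F(Q_t\cap K_2)\rangle$ are different. No computational restrictions on constructing the queries or on decoding are imposed.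
   Formalization: At α = 1 the denominator log α is 0 and the bound in (i) is undefined; the formal statement takes the denominator to be max{1, log₂ α}, which is log₂ α for every α ≥ 2 and gives the bound k log(n/k) at α = 1. *)

theory Defs
  imports Complex_Main
begin

text \<open>
  The ground set is \<open>{1..n}\<close>. A feedback function is a total function on \<open>nat set\<close>, with an
  arbitrary result type; only its values on subsets of \<open>{1..n}\<close> ever matter.
\<close>

definition capped :: "nat \<Rightarrow> nat \<Rightarrow> (nat set \<Rightarrow> 'b) \<Rightarrow> bool" where
  "capped n \<alpha> F \<longleftrightarrow> (\<exists>v. \<forall>X. X \<subseteq> {1..n} \<longrightarrow> card X > \<alpha> \<longrightarrow> F X = v)"

definition min_feedback :: "nat \<Rightarrow> nat set \<Rightarrow> nat" where
  "min_feedback \<alpha> X = min (card X) \<alpha>"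

definition feedback_vector :: "(nat set \<Rightarrow> 'b) \<Rightarrow> nat set list \<Rightarrow> nat set \<Rightarrow> 'b list" where
  "feedback_vector F Qs K = map (\<lambda>Q. F (Q \<inter> K)) Qs"

definition solves_group_testing :: "nat \<Rightarrow> nat \<Rightarrow> (nat set \<Rightarrow> 'b) \<Rightarrow> nat set list \<Rightarrow> bool" where
  "solves_group_testing n k F Qs \<longleftrightarrow>
     (\<forall>Q \<in> set Qs. Q \<subseteq> {1..n}) \<and>
     (\<forall>K1 K2. K1 \<subseteq> {1..n} \<longrightarrow> K2 \<subseteq> {1..n} \<longrightarrow> card K1 \<le> k \<longrightarrow> card K2 \<le> k \<longrightarrow> K1 \<noteq> K2 \<longrightarrow>
        feedback_vector F Qs K1 \<noteq> feedback_vector F Qs K2)"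

text \<open>
  The logarithm used as a denominator: it equals \<open>log 2 \<alpha>\<close> for \<open>\<alpha> \<ge> 2\<close>. At \<open>\<alpha> = 1\<close>, where
  \<open>log 2 \<alpha> = 0\<close> and Isabelle's division by zero would silently drop the term \<open>k log (n/k) / log \<alpha>\<close>,
  it equals \<open>1\<close>, giving the usual bound \<open>k log (n/k)\<close> for binary feedback.
\<close>

definition log_cap :: "nat \<Rightarrow> real" where
  "log_cap \<alpha> = max 1 (log 2 (real \<alpha>))"

end

theory Submission
  imports Defs
begin

text \<open>
  For the quadratic term, it suffices to find a set \<open>K\<close> of fewer than \<open>k\<close> elements and an
  \<open>x \<notin> K\<close> such that every query through \<open>x\<close> meets \<open>K\<close> in more than \<open>\<alpha>\<close> elements: then \<open>K\<close> and
  \<open>K \<union> {x}\<close> give the same feedback. If the number \<open>t\<close> of queries is small, those of size at most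
  \<open>\<alpha> + 1\<close> cover at most half of the ground set; \<open>x\<close> is chosen outside them. Minimising the deficit
  \<open>\<Sum>Q. max 0 (\<alpha> + 1 - |Q \<inter> K|)\<close> plus \<open>d |K|\<close> with \<open>d \<approx> k / (4\<alpha>)\<close> yields a \<open>K\<close> with
  \<open>|K| = O(t \<alpha>\<^sup>2 / k)\<close>, which is less than \<open>k / 4\<close>, such that every remaining \<open>x\<close> lies
  in at most \<open>d\<close> deficient queries. These are repaired by adding \<open>\<alpha> + 1\<close> elements from each of them.
  The logarithmic term follows by counting feedback vectors.
\<close>

text \<open>Local optimality: adding \<open>x\<close> to a minimiser of
  \<open>\<Phi> K + d * card K\<close> lowers \<open>\<Phi>\<close> by the number of deficient
  queries through \<open>x\<close> and costs \<open>d\<close>, so that number is at most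
  \<open>d\<close>. Comparison with the empty set gives the size bound.\<close>

lemma exists_few_deficient:
  fixes \<Q> :: "'a set set"
  assumes "finite \<Q>" "finite U"
  obtains K where "K \<subseteq> U" "d * card K \<le> b * card \<Q>"
    "\<And>x. x \<in> U - K \<Longrightarrow> card {Q \<in> \<Q>. x \<in> Q \<and> card (Q \<inter> K) < b} \<le> d"
proof -
  define \<Phi> where "\<Phi> K = (\<Sum>Q\<in>\<Q>. b - card (Q \<inter> K))" for K
  define K where "K = arg_min_on (\<lambda>K. \<Phi> K + d * card K) (Pow U)"
  have KU: "K \<subseteq> U"
    using arg_min_if_finite(1)[of "Pow U" "\<lambda>K. \<Phi> K + d * card K"] assms(2)
    by (auto simp: K_def)
  have K_min: "\<Phi> K + d * card K \<le> \<Phi> L + d * card L" if "L \<subseteq> U" for L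
    using arg_min_least[of "Pow U" L "\<lambda>K. \<Phi> K + d * card K"] assms(2) that
    by (auto simp: K_def)
  have finK: "finite K"
    using KU assms(2) finite_subset by blast
  have "d * card K \<le> \<Phi> {}"
    using K_min[of "{}"] by simp
  hence size: "d * card K \<le> b * card \<Q>"
    by (simp add: \<Phi>_def mult.commute)
  have few: "card {Q \<in> \<Q>. x \<in> Q \<and> card (Q \<inter> K) < b} \<le> d" if x: "x \<in> U - K" for x
  proof -
    \<comment> \<open>Truncated subtraction matters here: a query already met in \<open>b\<close>
      elements gains nothing from \<open>x\<close>, every other query through \<open>x\<close> gains
      exactly one.\<close>
    have "b - card (Q \<inter> K) = (b - card (Q \<inter> insert x K)) +
        (if x \<in> Q \<and> card (Q \<inter> K) < b then 1 else 0)" for Q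
    proof (cases "x \<in> Q")
      case True
      hence "card (Q \<inter> insert x K) = Suc (card (Q \<inter> K))"
        using x finK by (simp add: Int_insert_right)
      thus ?thesis using True by auto
    qed (simp add: Int_insert_right)
    hence "\<Phi> K = (\<Sum>Q\<in>\<Q>. (b - card (Q \<inter> insert x K)) +
        (if x \<in> Q \<and> card (Q \<inter> K) < b then 1 else 0))"
      unfolding \<Phi>_def by (intro sum.cong) auto
    also have "\<dots> = \<Phi> (insert x K) + card {Q \<in> \<Q>. x \<in> Q \<and> card (Q \<inter> K) < b}"
      using assms(1) by (simp add: sum.distrib \<Phi>_def sum.If_cases Int_def)
    finally show ?thesis
      using K_min[of "insert x K"] x KU finK by simp
  qed
  show thesis using that KU size few by blast
qed

text \<open>Each deficient query through \<open>x\<close> is repaired with \<open>b\<close> of its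
  own elements. The strict bound \<open>b < card Q\<close> leaves that many after \<open>x\<close>
  is removed, and at most \<open>d\<close> queries need repair.\<close>

lemma exists_blocking_superset:
  fixes \<Q> :: "'a set set"
  assumes "finite \<Q>" "finite K" "x \<notin> K"
    and large: "\<And>Q. Q \<in> \<Q> \<Longrightarrow> x \<in> Q \<Longrightarrow> finite Q \<and> b < card Q"
    and few: "card {Q \<in> \<Q>. x \<in> Q \<and> card (Q \<inter> K) < b} \<le> d"
  obtains L where "L \<subseteq> K \<union> \<Union> \<Q>" "finite L" "x \<notin> L" "card L \<le> card K + d * b"
    "\<And>Q. Q \<in> \<Q> \<Longrightarrow> x \<in> Q \<Longrightarrow> b \<le> card (Q \<inter> L)"
proof -
  define \<D> where "\<D> = {Q \<in> \<Q>. x \<in> Q \<and> card (Q \<inter> K) < b}"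
  have fin\<D>: "finite \<D>"
    using assms(1) by (simp add: \<D>_def)
  have "\<exists>A. A \<subseteq> Q - {x} \<and> card A = b \<and> finite A" if "Q \<in> \<D>" for Q
  proof -
    have "finite Q" "b < card Q" "x \<in> Q"
      using large[of Q] that by (auto simp: \<D>_def)
    hence "b \<le> card (Q - {x})" by simp
    thus ?thesis by (rule obtain_subset_with_card_n) blast
  qed
  then obtain A where A: "\<And>Q. Q \<in> \<D> \<Longrightarrow> A Q \<subseteq> Q - {x} \<and> card (A Q) = b \<and> finite (A Q)"
    by metis
  define L where "L = K \<union> (\<Union>Q\<in>\<D>. A Q)"
  have finL: "finite L"
    using A fin\<D> assms(2) by (auto simp: L_def)
  have "card (\<Union>Q\<in>\<D>. A Q) \<le> (\<Sum>Q\<in>\<D>. card (A Q))"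
    using fin\<D> by (rule card_UN_le)
  also have "\<dots> = card \<D> * b"
    using A by simp
  also have "\<dots> \<le> d * b"
    using few by (simp add: \<D>_def)
  finally have "card L \<le> card K + d * b"
    unfolding L_def by (meson add_left_mono card_Un_le order_trans)
  moreover have "b \<le> card (Q \<inter> L)" if "Q \<in> \<Q>" "x \<in> Q" for Q
  proof (cases "Q \<in> \<D>")
    case True
    hence "A Q \<subseteq> Q \<inter> L" using A by (auto simp: L_def)
    thus ?thesis using A[OF True] finL card_mono[of "Q \<inter> L" "A Q"] by simp
  next
    case False
    hence "b \<le> card (Q \<inter> K)" using that by (simp add: \<D>_def)
    also have "\<dots> \<le> card (Q \<inter> L)"
      using finL by (intro card_mono) (auto simp: L_def)
    finally show ?thesis .
  qed
  moreover have "L \<subseteq> K \<union> \<Union> \<Q>"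
    using A by (fastforce simp: L_def \<D>_def)
  moreover have "x \<notin> L"
    using A assms(3) by (auto simp: L_def)
  ultimately show thesis using that finL by blast
qed

text \<open>Adding \<open>x\<close> changes only the queries through \<open>x\<close>, and on those
  both intersections exceed the cap. Strictness of \<open>card K < k\<close> keeps
  \<open>insert x K\<close> admissible.\<close>

lemma not_solves_if_blocked:
  assumes capped: "capped n \<alpha> F"
    and K: "K \<subseteq> {1..n}" "x \<in> {1..n}" "x \<notin> K" "card K < k"
    and blocked: "\<And>Q. Q \<in> set Qs \<Longrightarrow> x \<in> Q \<Longrightarrow> \<alpha> < card (Q \<inter> K)"
  shows "\<not> solves_group_testing n k F Qs"
proof
  assume solves: "solves_group_testing n k F Qs"
  obtain v where v: "\<And>X. X \<subseteq> {1..n} \<Longrightarrow> \<alpha> < card X \<Longrightarrow> F X = v"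
    using capped by (auto simp: capped_def)
  have finK: "finite K"
    using K(1) finite_subset by blast
  have "F (Q \<inter> K) = F (Q \<inter> insert x K)" if "Q \<in> set Qs" for Q
  proof (cases "x \<in> Q")
    case True
    have "card (Q \<inter> K) \<le> card (Q \<inter> insert x K)"
      using finK by (intro card_mono) auto
    hence "\<alpha> < card (Q \<inter> insert x K)"
      using blocked[OF that True] by simp
    moreover have "Q \<inter> K \<subseteq> {1..n}" "Q \<inter> insert x K \<subseteq> {1..n}"
      using K by auto
    ultimately show ?thesis
      using v blocked[OF that True] by metis
  qed (simp add: Int_insert_right)
  hence "feedback_vector F Qs K = feedback_vector F Qs (insert x K)"
    by (simp add: feedback_vector_def)
  moreover have "insert x K \<subseteq> {1..n}" "card (insert x K) \<le> k" "K \<noteq> insert x K" "card K \<le> k"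
    using K finK by auto
  ultimately show False
    using solves K(1) unfolding solves_group_testing_def by blast
qed

lemma capped_min_feedback: "capped n \<alpha> (min_feedback \<alpha>)"
  by (auto simp: capped_def min_feedback_def)

lemma solves_length_pos:
  assumes "solves_group_testing n k F Qs" "1 \<le> k" "1 \<le> n"
  shows "0 < length Qs"
proof (rule ccontr)
  assume "\<not> 0 < length Qs"
  hence "feedback_vector F Qs {} = feedback_vector F Qs {1}"
    by (simp add: feedback_vector_def)
  moreover have "{} \<subseteq> {1..n}" "{1} \<subseteq> {1..n}" "card ({}::nat set) \<le> k" "card {1::nat} \<le> k"
    using assms(2,3) by auto
  ultimately show False
    using assms(1) unfolding solves_group_testing_def by blast
qed

lemma capped_quadratic_bound:
  assumes "1 \<le> \<alpha>" "\<alpha> \<le> k" "k \<le> n"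
    and capped: "capped n \<alpha> F" and solves: "solves_group_testing n k F Qs"
  shows "1/128 * min ((real k / real \<alpha>)^2) (real n / real \<alpha>) \<le> real (length Qs)"
proof (cases "k < 8 * \<alpha>")
  \<comment> \<open>Here the claimed bound is at most 64/128, so the existence of a single query
    suffices.\<close>
  case True
  have "real k / real \<alpha> \<le> 8"
    using True assms(1) by (simp add: divide_le_eq)
  hence "(real k / real \<alpha>)^2 \<le> 8^2"
    by (intro power_mono) auto
  moreover have "1 \<le> real (length Qs)"
    using solves_length_pos[OF solves] assms(1-3) by (simp add: Suc_le_eq)
  ultimately show ?thesis by simp
next
  case False
  define t where "t = length Qs"
  show ?thesis
  proof (rule ccontr)
    assume "\<not> ?thesis"
    hence small: "128 * real t < (real k / real \<alpha>)^2" "128 * real t < real n / real \<alpha>"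
      by (auto simp: t_def)
    have "real (128 * t * \<alpha>) < real n" "real (128 * t * \<alpha>^2) < real (k^2)"
      using small assms(1) by (auto simp: field_simps power2_eq_square)
    hence small_n: "128 * t * \<alpha> < n" and small_k: "128 * t * \<alpha>^2 < k^2"
      by (simp_all only: of_nat_less_iff)
    \<comment> \<open>Exceeding the cap takes \<alpha> + 1 elements.\<close>
    define b where "b = Suc \<alpha>"
    have b: "b \<le> 2 * \<alpha>" "0 < b"
      using assms(1) by (auto simp: b_def)
    \<comment> \<open>The repair will cost at most \<open>d * b\<close> \<le> k/4 elements. In this
      case k \<ge> 8\<alpha> \<ge> 4b, so \<open>d\<close> is positive and rounding down loses at
      most a factor 2.\<close>
    define d where "d = k div (4 * b)"
    have db: "4 * (d * b) \<le> k"
      using div_times_less_eq_dividend[of k "4 * b"] by (simp add: d_def ac_simps)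
    have "4 * b \<le> k"
      using False b by simp
    hence "1 \<le> d"
      using div_le_mono[of "4 * b" k "4 * b"] b by (simp add: d_def)
    have "k < 4 * b * Suc d"
      using dividend_less_times_div[of "4 * b" k] b by (simp add: d_def)
    also have "\<dots> \<le> 4 * b * (2 * d)"
      using \<open>1 \<le> d\<close> by (intro mult_le_mono2) simp
    also have "\<dots> \<le> 4 * (2 * \<alpha>) * (2 * d)"
      using b(1) by (intro mult_le_mono1 mult_le_mono2)
    finally have k_le: "k < 16 * \<alpha> * d" by simp
    \<comment> \<open>Outside \<open>S\<close> every query through a point has more than
      \<open>b\<close> elements, as the repair step requires.\<close>
    define S where "S = \<Union>{Q \<in> set Qs. card Q \<le> b}"
    define U where "U = {1..n} - S"
    have Qsub: "Q \<subseteq> {1..n}" if "Q \<in> set Qs" for Q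
      using solves that by (auto simp: solves_group_testing_def)
    have card_set: "card (set Qs) \<le> t"
      by (simp add: t_def card_length)
    have "card S \<le> (\<Sum>Q\<in>{Q \<in> set Qs. card Q \<le> b}. card Q)"
      unfolding S_def by (rule card_Union_le_sum_card)
    also have "\<dots> \<le> card {Q \<in> set Qs. card Q \<le> b} * b"
      using sum_bounded_above[of "{Q \<in> set Qs. card Q \<le> b}" card b] by simp
    also have "\<dots> \<le> t * (2 * \<alpha>)"
      using card_set b(1) card_mono[of "set Qs" "{Q \<in> set Qs. card Q \<le> b}"]
      by (intro mult_le_mono) auto
    finally have "card S \<le> t * (2 * \<alpha>)" .
    moreover have "finite S"
      using Qsub by (auto simp: S_def intro: finite_subset)
    hence "n \<le> card U + card S"
      using diff_card_le_card_Diff[of S "{1..n}"] by (simp add: U_def)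
    ultimately have cardU: "n < 2 * card U"
      using small_n by simp
    obtain K where K: "K \<subseteq> U" "d * card K \<le> b * card (set Qs)"
      and few: "\<And>x. x \<in> U - K \<Longrightarrow> card {Q \<in> set Qs. x \<in> Q \<and> card (Q \<inter> K) < b} \<le> d"
      using exists_few_deficient[of "set Qs" U d b] by (auto simp: U_def)
    \<comment> \<open>This is where 128 = 4 * 16 * 2 comes from: k < 16\<alpha>d and d|K| \<le>
      2\<alpha>t give k|K| \<le> 32 t \<alpha>^2, which is below k^2/4.\<close>
    have "k * card K \<le> 16 * \<alpha> * (d * card K)"
      using k_le mult_le_mono1[of k "16 * \<alpha> * d" "card K"] by (simp add: ac_simps)
    also have "\<dots> \<le> 16 * \<alpha> * (2 * \<alpha> * t)"
      using K(2) mult_le_mono[OF b(1) card_set] by (intro mult_le_mono2) linarith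
    finally have "k * card K \<le> 32 * (t * \<alpha>^2)"
      by (simp add: power2_eq_square ac_simps)
    hence "4 * (k * card K) < k^2"
      using small_k by linarith
    hence cardK: "4 * card K < k"
      by (simp add: power2_eq_square)
    have finU: "finite U" by (simp add: U_def)
    hence finK: "finite K" using K(1) finite_subset by blast
    have "card K < card U"
      using cardK cardU assms(3) by simp
    hence "\<not> U \<subseteq> K"
      using card_mono[OF finK] by (metis not_le)
    then obtain x where x: "x \<in> U - K" by blast
    have large: "finite Q \<and> b < card Q" if "Q \<in> set Qs" "x \<in> Q" for Q
    proof
      show "finite Q"
        using Qsub[OF that(1)] by (rule finite_subset) simp
      show "b < card Q"
        using that x not_le by (auto simp: U_def S_def)
    qed
    obtain L where L: "L \<subseteq> K \<union> \<Union> (set Qs)" "x \<notin> L" "card L \<le> card K + d * b"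
      "\<And>Q. Q \<in> set Qs \<Longrightarrow> x \<in> Q \<Longrightarrow> b \<le> card (Q \<inter> L)"
      using exists_blocking_superset[OF finite_set finK _ large few[OF x]] x by (metis DiffD2)
    have "L \<subseteq> {1..n}"
      using L(1) K(1) Qsub by (auto simp: U_def)
    \<comment> \<open>Less than k/4 from \<open>K\<close> plus at most k/4 from the repair.\<close>
    moreover have "card L < k"
      using L(3) db cardK by linarith
    moreover have "\<alpha> < card (Q \<inter> L)" if "Q \<in> set Qs" "x \<in> Q" for Q
      using L(4)[OF that] by (simp add: b_def)
    ultimately show False
      using not_solves_if_blocked[OF capped, of L x k Qs] L(2) x solves by (auto simp: U_def)
  qed
qed

text \<open>Hidden sets of size exactly \<open>k\<close> already need distinct vectors, whose
  entries take only the \<alpha> + 1 values 0, ..., \<alpha>.\<close>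

lemma solves_choose_le_power:
  assumes "solves_group_testing n k (min_feedback \<alpha>) Qs"
  shows "n choose k \<le> (\<alpha> + 1) ^ length Qs"
proof -
  define \<K> where "\<K> = {K. K \<subseteq> {1..n} \<and> card K = k}"
  define V where "V = {xs. set xs \<subseteq> {0..\<alpha>} \<and> length xs = length Qs}"
  have "inj_on (feedback_vector (min_feedback \<alpha>) Qs) \<K>"
  proof (rule inj_onI)
    fix K L assume "K \<in> \<K>" "L \<in> \<K>"
      and eq: "feedback_vector (min_feedback \<alpha>) Qs K = feedback_vector (min_feedback \<alpha>) Qs L"
    hence "K \<subseteq> {1..n}" "L \<subseteq> {1..n}" "card K \<le> k" "card L \<le> k"
      by (auto simp: \<K>_def)
    thus "K = L" using assms eq unfolding solves_group_testing_def by blast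
  qed
  moreover have "feedback_vector (min_feedback \<alpha>) Qs ` \<K> \<subseteq> V"
    by (auto simp: V_def feedback_vector_def min_feedback_def)
  moreover have "finite V"
    unfolding V_def by (rule finite_lists_length_eq) simp
  ultimately have "card \<K> \<le> card V"
    using card_inj_on_le by blast
  thus ?thesis
    by (simp add: \<K>_def V_def n_subsets card_lists_length_eq)
qed

text \<open>Counting produces base \<alpha> + 1. For \<alpha> \<ge> 2, \<alpha> + 1 \<le> \<alpha>^2
  costs a factor 2; for \<alpha> = 1 the floor 1 in \<open>log_cap\<close> takes over.\<close>

lemma log_Suc_le_log_cap:
  assumes "1 \<le> \<alpha>"
  shows "log 2 (real (\<alpha> + 1)) \<le> 2 * log_cap \<alpha>"
proof (cases "\<alpha> = 1")
  case False
  hence "2 \<le> \<alpha>" using assms by simp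
  hence "\<alpha> + 1 \<le> \<alpha> * \<alpha>"
    using mult_le_mono1[of 2 \<alpha> \<alpha>] by linarith
  hence "real (\<alpha> + 1) \<le> real \<alpha> ^ 2"
    by (simp only: power2_eq_square of_nat_mult[symmetric] of_nat_le_iff)
  hence "log 2 (real (\<alpha> + 1)) \<le> log 2 (real \<alpha> ^ 2)"
    using assms by (subst log_le_cancel_iff) auto
  also have "\<dots> = 2 * log 2 (real \<alpha>)"
    using assms by (simp add: log_nat_power)
  finally show ?thesis by (simp add: log_cap_def)
qed (simp add: log_cap_def)

text \<open>Take logarithms in (n/k)^k \<le> \<open>n choose k\<close> \<le> (\<alpha> + 1)^t, where
  t is the number of queries.\<close>

lemma min_feedback_log_bound:
  assumes "1 \<le> \<alpha>" "\<alpha> \<le> k" "k \<le> n" "solves_group_testing n k (min_feedback \<alpha>) Qs"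
  shows "1/2 * (real k * (log 2 (real n / real k) / log_cap \<alpha>)) \<le> real (length Qs)"
proof -
  have pos: "0 < log_cap \<alpha>" by (simp add: log_cap_def)
  have nk: "0 < real n / real k" using assms(1-3) by simp
  have "(real n / real k) ^ k \<le> real (n choose k)"
    using binomial_ge_n_over_k_pow_k[of k n, where 'a = real] assms(3) by simp
  also have "\<dots> \<le> real (\<alpha> + 1) ^ length Qs"
    using solves_choose_le_power[OF assms(4)] by (metis of_nat_le_iff of_nat_power)
  finally have "log 2 ((real n / real k) ^ k) \<le> log 2 (real (\<alpha> + 1) ^ length Qs)"
    using nk by (subst log_le_cancel_iff) auto
  hence "real k * log 2 (real n / real k) \<le> real (length Qs) * log 2 (real (\<alpha> + 1))"
    using nk by (simp add: log_nat_power)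
  also have "\<dots> \<le> real (length Qs) * (2 * log_cap \<alpha>)"
    using log_Suc_le_log_cap[OF assms(1)] by (intro mult_left_mono) auto
  finally show ?thesis
    using pos by (simp add: field_simps)
qed

theorem theorem2:
  "(\<exists>c::real. c > 0 \<and>
      (\<forall>(n::nat) (k::nat) (\<alpha>::nat) (Qs :: nat set list).
         1 \<le> \<alpha> \<and> \<alpha> \<le> k \<and> k \<le> n \<and> solves_group_testing n k (min_feedback \<alpha>) Qs \<longrightarrow>
         real (length Qs) \<ge>
           c * (min ((real k / real \<alpha>)^2) (real n / real \<alpha>)
                + real k * (log 2 (real n / real k) / log_cap \<alpha>))))
   \<and>
   (\<exists>c::real. c > 0 \<and>
      (\<forall>(n::nat) (k::nat) (\<alpha>::nat) (F :: nat set \<Rightarrow> 'b) (Qs :: nat set list).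
         1 \<le> \<alpha> \<and> \<alpha> \<le> k \<and> k \<le> n \<and> capped n \<alpha> F \<and> solves_group_testing n k F Qs \<longrightarrow>
         real (length Qs) \<ge>
           c * min ((real k / real \<alpha>)^2) (real n / real \<alpha>)))"
proof (intro conjI)
  show "\<exists>c::real. c > 0 \<and>
      (\<forall>(n::nat) (k::nat) (\<alpha>::nat) (Qs :: nat set list).
         1 \<le> \<alpha> \<and> \<alpha> \<le> k \<and> k \<le> n \<and> solves_group_testing n k (min_feedback \<alpha>) Qs \<longrightarrow>
         real (length Qs) \<ge>
           c * (min ((real k / real \<alpha>)^2) (real n / real \<alpha>)
                + real k * (log 2 (real n / real k) / log_cap \<alpha>)))"
  \<comment> \<open>Half of the smaller constant 1/128, so that each of the two summands is at most
    half the number of queries.\<close>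
  proof (intro exI[of _ "1/256"] conjI allI impI)
    fix n k \<alpha> :: nat and Qs :: "nat set list"
    assume h: "1 \<le> \<alpha> \<and> \<alpha> \<le> k \<and> k \<le> n \<and> solves_group_testing n k (min_feedback \<alpha>) Qs"
    define A B where "A = min ((real k / real \<alpha>)^2) (real n / real \<alpha>)"
      and "B = real k * (log 2 (real n / real k) / log_cap \<alpha>)"
    have "1/128 * A \<le> real (length Qs)"
      unfolding A_def using h capped_quadratic_bound capped_min_feedback by blast
    moreover have "1/2 * B \<le> real (length Qs)"
      unfolding B_def using h min_feedback_log_bound by blast
    ultimately have "1/256 * (A + B) \<le> real (length Qs)"
      by simp
    thus "1/256 * (min ((real k / real \<alpha>)^2) (real n / real \<alpha>)
        + real k * (log 2 (real n / real k) / log_cap \<alpha>)) \<le> real (length Qs)"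
      unfolding A_def B_def .
  qed simp
  show "\<exists>c::real. c > 0 \<and>
      (\<forall>(n::nat) (k::nat) (\<alpha>::nat) (F :: nat set \<Rightarrow> 'b) (Qs :: nat set list).
         1 \<le> \<alpha> \<and> \<alpha> \<le> k \<and> k \<le> n \<and> capped n \<alpha> F \<and> solves_group_testing n k F Qs \<longrightarrow>
         real (length Qs) \<ge>
           c * min ((real k / real \<alpha>)^2) (real n / real \<alpha>))"
    using capped_quadratic_bound by (intro exI[of _ "1/128"] conjI allI impI) (simp, blast)
qed

end
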